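(* Let $\ell\in\frac12\mathbb{N}$. The commutant $$\{V^\ell(a):a\in A_*\}'=\{Y\in\mathrm{End}(H^\ell):V^\ell(a)Y=YV^\ell(a)\text{ for all }a\in A_*\}=\{v^\ell(a):a\in A_*\}'$$ is spanned by the matrices $I$ and $J$.
   Context: $\mathbb{N}=\{0,1,2,\dots\}$. $K=\mathrm{SU}(2)$, $U=K\times K$. $m_t=\mathrm{diag}(e^{it/2},e^{-it/2})$, $a_t=(m_t,m_{-t})$, $A_*=\{a_t:0\le t<4\pi\}$. For $\ell\in\frac12\mathbb{N}$, $H^\ell=\mathbb{C}[x,y]_{2\ell}$ with $K$ acting by $T^\ell(k)p=p\circ k^t$ and orthonormal basis $\psi^\ell_j=\binom{2\ell}{\ell-j}^{1/2}x^{\ell-j}y^{\ell+j}$, $j=-\ell,\dots,\ell$; endomorphisms are written as matrices in this basis. For $(\ell_1,\ell_2)$ with $|\ell_1-\ell_2|\le\ell\le\ell_1+\ell_2$, $\ell_1+\ell_2-\ell\in\mathbb{Z}$, let $\beta^{\ell_1,\ell_2}_\ell:H^\ell\to H^{\ell_1}\otimes H^{\ell_2}$, $\psi^\ell_j\mapsto\sum_{j_1,j_2}C^{\ell_1,\ell_2,\ell}_{j_1,j_2,j}\psi^{\ell_1}_{j_1}\otimes\psi^{\ell_2}_{j_2}$ ($C$ = standard Clebsch-Gordan coefficients), and $\Phi^\ell_{\ell_1,\ell_2}(x)=(\beta^{\ell_1,\ell_2}_\ell)^*\circ T^{\ell_1,\ell_2}(x)\circ\beta^{\ell_1,\ell_2}_\ell$,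 with $T^{\ell_1,\ell_2}$ the outer tensor product representation of $U$. On $A_*$ it is diagonal with $(\Phi^\ell_{\ell_1,\ell_2}(a_t))_{j,j}=\sum_{j_1,j_2}e^{i(j_2-j_1)t}(C^{\ell_1,\ell_2,\ell}_{j_1,j_2,j})^2$. The full spherical function of degree $0$ is $(\Phi^\ell_0(a))_{p,q}=\left(\Phi^\ell_{\frac{\ell+p}{2},\frac{\ell-p}{2}}(a)\right)_{q,q}$, $p,q\in\{-\ell,\dots,\ell\}$. Put $v^\ell(a)=\Phi^\ell_0(a)\left(\Phi^\ell_0(a)\right)^*$ and $V^\ell(a_t)=v^\ell(a_t)\sin^2 t$. $I$ is the identity and $J\in\mathrm{End}(H^\ell)$ is given by $J\psi^\ell_j=\psi^\ell_{-j}$. *)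

theory Defs
  imports Complex_Main "Jordan_Normal_Form.Schur_Decomposition"
begin

text \<open>
  A spin \<open>l\<close> in \<open>(1/2)\<nat>\<close> is encoded by the natural number \<open>n = 2 l\<close>, and a weight index
  \<open>j\<close> in \<open>{-l, ..., l}\<close> by the natural number \<open>b = l + j\<close> in \<open>{0..n}\<close>, so that \<open>j = b - n/2\<close>.
  Endomorphisms of the space \<open>H\<^sup>l\<close> are \<open>(n+1) \<times> (n+1)\<close> matrices with these shifted indices.
\<close>


subsection \<open>The group\<close>

definition SU2 :: "complex mat set" where
  "SU2 = {k \<in> carrier_mat 2 2. mat_adjoint k * k = 1\<^sub>m 2 \<and> det k = 1}"

definition m_elt :: "real \<Rightarrow> complex mat" where
  "m_elt t = mat 2 2 (\<lambda>(i, j). if i \<noteq> j then 0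
     else if i = 0 then cis (t / 2) else cis (- t / 2))"

definition a_elt :: "real \<Rightarrow> complex mat \<times> complex mat" where
  "a_elt t = (m_elt t, m_elt (- t))"

definition A_star :: "(complex mat \<times> complex mat) set" where
  "A_star = {a_elt t | t. 0 \<le> t \<and> t < 4 * pi}"


subsection \<open>The representations\<close>

text \<open>Forms of degree \<open>n\<close> are identified with the polynomial functions they define on \<open>\<complex>\<^sup>2\<close>.\<close>

definition H :: "nat \<Rightarrow> (complex \<times> complex \<Rightarrow> complex) set" where
  "H n = {p. \<exists>c :: nat \<Rightarrow> complex. p = (\<lambda>(x, y). \<Sum>i\<le>n. c i * x ^ (n - i) * y ^ i)}"

definition psi :: "nat \<Rightarrow> nat \<Rightarrow> complex \<times> complex \<Rightarrow> complex" where
  "psi n b = (\<lambda>(x, y). of_real (sqrt (real (n choose (n - b)))) * x ^ (n - b) * y ^ b)"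

definition lin_map :: "complex mat \<Rightarrow> complex \<times> complex \<Rightarrow> complex \<times> complex" where
  "lin_map k = (\<lambda>(x, y). (k $$ (0, 0) * x + k $$ (0, 1) * y, k $$ (1, 0) * x + k $$ (1, 1) * y))"

definition T_op :: "complex mat \<Rightarrow> (complex \<times> complex \<Rightarrow> complex) \<Rightarrow> complex \<times> complex \<Rightarrow> complex" where
  "T_op k p = p \<circ> lin_map (transpose_mat k)"

definition coord :: "nat \<Rightarrow> (complex \<times> complex \<Rightarrow> complex) \<Rightarrow> nat \<Rightarrow> complex" where
  "coord n p = (THE c. (\<forall>i>n. c i = 0) \<and> p = (\<lambda>z. \<Sum>i\<le>n. c i * psi n i z))"

definition T_mat :: "nat \<Rightarrow> complex mat \<Rightarrow> complex mat" where
  "T_mat n k = mat (n + 1) (n + 1) (\<lambda>(i, j). coord n (T_op k (psi n j)) i)"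

text \<open>The vector \<open>psi n1 b1 \<otimes> psi n2 b2\<close> has index \<open>b1 * (n2 + 1) + b2\<close> in the tensor product basis.\<close>

definition kronecker :: "complex mat \<Rightarrow> complex mat \<Rightarrow> complex mat" where
  "kronecker A B = mat (dim_row A * dim_row B) (dim_col A * dim_col B)
     (\<lambda>(i, j). A $$ (i div dim_row B, j div dim_col B) * B $$ (i mod dim_row B, j mod dim_col B))"

definition T_outer :: "nat \<Rightarrow> nat \<Rightarrow> complex mat \<times> complex mat \<Rightarrow> complex mat" where
  "T_outer n1 n2 x = kronecker (T_mat n1 (fst x)) (T_mat n2 (snd x))"


subsection \<open>Clebsch-Gordan coefficients\<close>

definition rfact :: "real \<Rightarrow> real" where
  "rfact x = fact (nat \<lfloor>x\<rfloor>)"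

text \<open>
  Racah's formula, in the Condon-Shortley sign convention. Here the spins and weights are actual
  half-integers. The sum ranges over those \<open>k\<close> for which all factorials have a nonnegative argument.
\<close>

definition clebsch_gordan :: "real \<Rightarrow> real \<Rightarrow> real \<Rightarrow> real \<Rightarrow> real \<Rightarrow> real \<Rightarrow> real" where
  "clebsch_gordan l1 l2 l j1 j2 j =
     (if j1 + j2 = j then
        sqrt ((2 * l + 1) * rfact (l + l1 - l2) * rfact (l - l1 + l2) * rfact (l1 + l2 - l)
              / rfact (l1 + l2 + l + 1))
      * sqrt (rfact (l + j) * rfact (l - j) * rfact (l1 + j1) * rfact (l1 - j1)
              * rfact (l2 + j2) * rfact (l2 - j2))
      * (\<Sum>k \<in> {k :: nat. real k \<le> l1 + l2 - l \<and> real k \<le> l1 - j1 \<and> real k \<le> l2 + j2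
                    \<and> 0 \<le> l - l2 + j1 + real k \<and> 0 \<le> l - l1 - j2 + real k}.
           (-1) ^ k / (fact k * rfact (l1 + l2 - l - real k) * rfact (l1 - j1 - real k)
              * rfact (l2 + j2 - real k) * rfact (l - l2 + j1 + real k) * rfact (l - l1 - j2 + real k)))
      else 0)"


subsection \<open>Spherical functions\<close>

text \<open>
  The matrix of \<open>\<beta>\<close> from \<open>H\<^sup>l\<close> to the tensor product. The bases are orthonormal, so its adjoint is
  given by the conjugate transpose.
\<close>

definition beta_mat :: "nat \<Rightarrow> nat \<Rightarrow> nat \<Rightarrow> complex mat" where
  "beta_mat n1 n2 n = mat ((n1 + 1) * (n2 + 1)) (n + 1) (\<lambda>(i, b).
     of_real (clebsch_gordan (n1 / 2) (n2 / 2) (n / 2)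
       (real (i div (n2 + 1)) - n1 / 2) (real (i mod (n2 + 1)) - n2 / 2) (real b - n / 2)))"

definition Phi :: "nat \<Rightarrow> nat \<Rightarrow> nat \<Rightarrow> complex mat \<times> complex mat \<Rightarrow> complex mat" where
  "Phi n1 n2 n x = mat_adjoint (beta_mat n1 n2 n) * T_outer n1 n2 x * beta_mat n1 n2 n"

text \<open>
  If \<open>p = l + p' \<in> {0..n}\<close> is the shifted index of \<open>p'\<close>, then the spins \<open>(l + p')/2\<close> and
  \<open>(l - p')/2\<close> are encoded by \<open>p\<close> and \<open>n - p\<close>.
\<close>

definition Phi0 :: "nat \<Rightarrow> complex mat \<times> complex mat \<Rightarrow> complex mat" where
  "Phi0 n a = mat (n + 1) (n + 1) (\<lambda>(p, q). Phi p (n - p) n a $$ (q, q))"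

definition v_mat :: "nat \<Rightarrow> complex mat \<times> complex mat \<Rightarrow> complex mat" where
  "v_mat n a = Phi0 n a * mat_adjoint (Phi0 n a)"

text \<open>\<open>V_mat n t\<close> is the value of \<open>V\<^sup>l\<close> at \<open>a_elt t\<close>.\<close>

definition V_mat :: "nat \<Rightarrow> real \<Rightarrow> complex mat" where
  "V_mat n t = complex_of_real ((sin t)\<^sup>2) \<cdot>\<^sub>m v_mat n (a_elt t)"

definition J_mat :: "nat \<Rightarrow> complex mat" where
  "J_mat n = mat (n + 1) (n + 1) (\<lambda>(i, j). if i = n - j then 1 else 0)"

definition commutant :: "nat \<Rightarrow> complex mat set \<Rightarrow> complex mat set" where
  "commutant n S = {Y \<in> carrier_mat (n + 1) (n + 1). \<forall>A \<in> S. A * Y = Y * A}"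


subsection \<open>The matrices of the representation are well defined\<close>

lemma psi_in_H:
  assumes "b \<le> n"
  shows "psi n b \<in> H n"
proof -
  have "psi n b = (\<lambda>(x, y). \<Sum>i\<le>n.
      (if i = b then of_real (sqrt (real (n choose (n - b)))) else 0) * x ^ (n - i) * y ^ i)"
    using assms by (auto simp: psi_def fun_eq_iff if_distrib [of "\<lambda>u. u * _"] sum.delta cong: if_cong)
  then show ?thesis unfolding H_def by (intro CollectI exI)
qed

lemma psi_basis:
  assumes "p \<in> H n"
  shows "\<exists>!c. (\<forall>i>n. c i = 0) \<and> p = (\<lambda>z. \<Sum>i\<le>n. c i * psi n i z)"
proof -
  define s where "s i = complex_of_real (sqrt (real (n choose (n - i))))" for i
  have s: "s i \<noteq> 0" if "i \<le> n" for i
    using that by (simp add: s_def)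
  have psi_s: "psi n i (x, y) = s i * x ^ (n - i) * y ^ i" for i x y
    by (simp add: psi_def s_def)
  obtain c where c: "p = (\<lambda>(x, y). \<Sum>i\<le>n. c i * x ^ (n - i) * y ^ i)"
    using assms unfolding H_def by blast
  define d where "d i = (if i \<le> n then c i / s i else 0)" for i
  have ex: "(\<forall>i>n. d i = 0) \<and> p = (\<lambda>z. \<Sum>i\<le>n. d i * psi n i z)"
    using s by (auto simp: c d_def fun_eq_iff psi_s intro!: sum.cong)
  show ?thesis
  proof (rule ex1I [of _ d])
    show "(\<forall>i>n. d i = 0) \<and> p = (\<lambda>z. \<Sum>i\<le>n. d i * psi n i z)" by (fact ex)
  next
    fix e assume e: "(\<forall>i>n. e i = 0) \<and> p = (\<lambda>z. \<Sum>i\<le>n. e i * psi n i z)"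
    have "(\<Sum>i\<le>n. (e i * s i) * y ^ i) = (\<Sum>i\<le>n. (d i * s i) * y ^ i)" for y
    proof -
      have "(\<Sum>i\<le>n. e i * psi n i (1, y)) = (\<Sum>i\<le>n. d i * psi n i (1, y))"
        using e ex by metis
      then show ?thesis by (simp add: psi_s mult.assoc)
    qed
    then have "\<forall>i\<le>n. e i * s i = d i * s i"
      using polyfun_eq_coeffs [where c = "\<lambda>i. e i * s i" and d = "\<lambda>i. d i * s i"] by blast
    then have "e i = d i" for i
      using s e ex by (cases "i \<le> n") auto
    then show "e = d" by blast
  qed
qed

lemma H_add: "p \<in> H n \<Longrightarrow> q \<in> H n \<Longrightarrow> (\<lambda>z. p z + q z) \<in> H n"
proof -
  assume "p \<in> H n" "q \<in> H n"
  then obtain c d where "p = (\<lambda>(x, y). \<Sum>i\<le>n. c i * x ^ (n - i) * y ^ i)"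
      "q = (\<lambda>(x, y). \<Sum>i\<le>n. d i * x ^ (n - i) * y ^ i)"
    unfolding H_def by blast
  then have "(\<lambda>z. p z + q z) = (\<lambda>(x, y). \<Sum>i\<le>n. (c i + d i) * x ^ (n - i) * y ^ i)"
    by (auto simp: fun_eq_iff sum.distrib algebra_simps)
  then show ?thesis unfolding H_def by (intro CollectI exI)
qed

lemma H_scale: "p \<in> H n \<Longrightarrow> (\<lambda>z. a * p z) \<in> H n"
proof -
  assume "p \<in> H n"
  then obtain c where "p = (\<lambda>(x, y). \<Sum>i\<le>n. c i * x ^ (n - i) * y ^ i)"
    unfolding H_def by blast
  then have "(\<lambda>z. a * p z) = (\<lambda>(x, y). \<Sum>i\<le>n. (a * c i) * x ^ (n - i) * y ^ i)"
    by (auto simp: fun_eq_iff sum_distrib_left algebra_simps)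
  then show ?thesis unfolding H_def by (intro CollectI exI)
qed

lemma H_mult_lin: "p \<in> H n \<Longrightarrow> (\<lambda>(x, y). (a * x + b * y) * p (x, y)) \<in> H (Suc n)"
proof -
  assume "p \<in> H n"
  then obtain c where c: "p = (\<lambda>(x, y). \<Sum>i\<le>n. c i * x ^ (n - i) * y ^ i)"
    unfolding H_def by blast
  define d where "d i = (if i \<le> n then a * c i else 0)" for i
  define e where "e i = (case i of 0 \<Rightarrow> 0 | Suc k \<Rightarrow> b * c k)" for i
  have "(a * x + b * y) * (\<Sum>i\<le>n. c i * x ^ (n - i) * y ^ i)
      = (\<Sum>i\<le>Suc n. (d i + e i) * x ^ (Suc n - i) * y ^ i)" for x y
  proof -
    have "(\<Sum>i\<le>Suc n. d i * x ^ (Suc n - i) * y ^ i) = a * x * (\<Sum>i\<le>n. c i * x ^ (n - i) * y ^ i)"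
      by (auto simp: d_def sum_distrib_left Suc_diff_le algebra_simps intro!: sum.cong)
    moreover have "(\<Sum>i\<le>Suc n. e i * x ^ (Suc n - i) * y ^ i)
        = b * y * (\<Sum>i\<le>n. c i * x ^ (n - i) * y ^ i)"
      unfolding sum.atMost_Suc_shift
      by (auto simp: e_def sum_distrib_left algebra_simps intro!: sum.cong)
    ultimately show ?thesis by (simp only: distrib_right sum.distrib)
  qed
  then have "(\<lambda>(x, y). (a * x + b * y) * p (x, y))
      = (\<lambda>(x, y). \<Sum>i\<le>Suc n. (d i + e i) * x ^ (Suc n - i) * y ^ i)"
    by (auto simp: c fun_eq_iff)
  then show ?thesis unfolding H_def by (intro CollectI exI)
qed

lemma H_lin_powers: "(\<lambda>(x, y). (a * x + b * y) ^ m * (c * x + d * y) ^ k) \<in> H (m + k)"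
proof (induction m)
  case 0
  show ?case
  proof (induction k)
    case 0
    show ?case unfolding H_def by (auto simp: fun_eq_iff intro!: exI [of _ "\<lambda>_. 1"])
  next
    case (Suc k)
    from H_mult_lin [OF this, of c d] show ?case by simp
  qed
next
  case (Suc m)
  from H_mult_lin [OF this, of a b] show ?case by (simp add: mult.assoc)
qed

lemma T_op_psi_in_H:
  assumes "b \<le> n"
  shows "T_op k (psi n b) \<in> H n"
proof -
  let ?k = "transpose_mat k"
  have "T_op k (psi n b) = (\<lambda>z. of_real (sqrt (real (n choose (n - b)))) *
      (\<lambda>(x, y). (?k $$ (0, 0) * x + ?k $$ (0, 1) * y) ^ (n - b)
        * (?k $$ (1, 0) * x + ?k $$ (1, 1) * y) ^ b) z)"
    by (auto simp: T_op_def lin_map_def psi_def fun_eq_iff)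
  moreover have "\<dots> \<in> H n"
    using H_lin_powers [of "?k $$ (0, 0)" "?k $$ (0, 1)" "n - b" "?k $$ (1, 0)" "?k $$ (1, 1)" b] assms
    by (intro H_scale) simp
  ultimately show ?thesis by simp
qed

lemma T_mat_columns:
  assumes "j \<le> n"
  shows "T_op k (psi n j) = (\<lambda>z. \<Sum>i\<le>n. T_mat n k $$ (i, j) * psi n i z)"
proof -
  have "T_op k (psi n j) = (\<lambda>z. \<Sum>i\<le>n. coord n (T_op k (psi n j)) i * psi n i z)"
    using theI' [OF psi_basis [OF T_op_psi_in_H [OF assms]]] unfolding coord_def by blast
  also have "\<dots> = (\<lambda>z. \<Sum>i\<le>n. T_mat n k $$ (i, j) * psi n i z)"
    using assms by (intro ext sum.cong) (auto simp: T_mat_def)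
  finally show ?thesis .
qed

lemma m_elt_in_SU2: "m_elt t \<in> SU2"
proof -
  have "mat_adjoint (m_elt t) * m_elt t = 1\<^sub>m 2"
    by (rule eq_matI)
      (auto simp: m_elt_def mat_adjoint_def mat_of_rows_def scalar_prod_def less_2_cases_iff
        cis_cnj cis_mult numeral_2_eq_2)
  moreover have "det (m_elt t) = 1"
    by (subst det_upper_triangular [of _ 2])
      (auto simp: m_elt_def diag_mat_def cis_mult numeral_2_eq_2)
  ultimately show ?thesis
    by (simp add: SU2_def m_elt_def)
qed

lemma A_star_subset: "A_star \<subseteq> SU2 \<times> SU2"
  using m_elt_in_SU2 by (auto simp: A_star_def a_elt_def)

end

theory Submission
  imports Defs
begin

text \<open>
  Since the spins \<open>p/2\<close> and \<open>(n - p)/2\<close> add up to \<open>n/2\<close>, the Clebsch-Gordan coefficients involved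
  have a closed form, and with \<open>z = cis t\<close> the \<open>(p, q)\<close> entry of the full spherical function becomes,
  up to the factor \<open>z ^ (- n/2) / (n choose q)\<close>, the coefficient of \<open>s ^ q\<close> in
  \<open>(z + s) ^ p (1 + s z) ^ (n - p)\<close> (\<open>Phi_top_a_elt\<close>, \<open>sph_poly_eq_coeff\<close>). Both symmetries used below are read
  off from this product: replacing \<open>z\<close> by \<open>1/z\<close> exchanges \<open>p\<close> and \<open>n - p\<close>, and so does reversing the
  order of the coefficients in \<open>s\<close>. They show that \<open>z ^ n v\<close> is a matrix of polynomials in \<open>z\<close>
  (\<open>v_mat_a_elt\<close>) and that \<open>v\<close> commutes with \<open>J\<close> (\<open>poly_v_poly_flip\<close>).

  Conversely, let \<open>Y\<close> commute with all values of \<open>V\<close>. As \<open>sin t\<close> does not vanish for \<open>0 < t < \<pi>\<close>,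
  \<open>Y\<close> commutes with \<open>z ^ n v\<close> at infinitely many \<open>z\<close>, hence with each of its coefficient matrices
  (\<open>commutant_V_coeff\<close>). The two lowest ones suffice. The coefficient of \<open>z ^ 0\<close> is \<open>D J\<close> with \<open>D\<close> the
  diagonal matrix with entries \<open>1 / (n choose p) ^ 2\<close>: as \<open>D\<close> is positive and commutes with \<open>J\<close>, the
  matrix \<open>Y\<close> commutes with both \<open>J\<close> and \<open>D\<close>, so row \<open>0\<close> of \<open>Y\<close> is zero outside the two corners
  (\<open>commutant_V_lowest\<close>). Subtracting a combination of \<open>I\<close> and \<open>J\<close> makes row \<open>0\<close> vanish. The
  coefficient of \<open>z ^ 1\<close>, multiplied by \<open>J\<close>, is a tridiagonal matrix with zero diagonal and nonzero
  entries next to it; commuting with it makes every row of \<open>Y\<close> vanish once row \<open>0\<close> does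
  (\<open>commutant_V_first_row\<close>).
\<close>

section \<open>Matrices and finite sums\<close>

lemma mat_adjoint_dim [simp]:
  "dim_row (mat_adjoint A) = dim_col A" "dim_col (mat_adjoint A) = dim_row A"
  by (auto simp: mat_adjoint_def)

lemma mat_adjoint_index:
  fixes A :: "complex mat"
  assumes "i < dim_col A" "j < dim_row A"
  shows "mat_adjoint A $$ (i, j) = cnj (A $$ (j, i))"
  using assms by (simp add: mat_adjoint_def mat_of_rows_index)

lemma index_mult_mat_sum:
  fixes A B :: "complex mat"
  assumes "A \<in> carrier_mat (n + 1) (n + 1)" "B \<in> carrier_mat (n + 1) (n + 1)" "i \<le> n" "j \<le> n"
  shows "(A * B) $$ (i, j) = (\<Sum>k\<le>n. A $$ (i, k) * B $$ (k, j))"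
proof -
  have "{0..<n + 1} = {..n}" by auto
  then show ?thesis
    using assms by (auto simp: scalar_prod_def intro!: sum.cong)
qed

lemma sum_div_mod:
  fixes f :: "nat \<Rightarrow> nat \<Rightarrow> 'a :: comm_monoid_add"
  shows "(\<Sum>i<(m + 1) * (k + 1). f (i div (k + 1)) (i mod (k + 1))) = (\<Sum>a\<le>m. \<Sum>b\<le>k. f a b)"
proof -
  have lt: "a * (k + 1) + b < (m + 1) * (k + 1)" if "a \<le> m" "b \<le> k" for a b
  proof -
    have "a * (k + 1) + b < (a + 1) * (k + 1)" using that by simp
    also have "\<dots> \<le> (m + 1) * (k + 1)" using that by (intro mult_le_mono1) simp
    finally show ?thesis .
  qed
  have d: "i div (k + 1) \<le> m" if "i < (m + 1) * (k + 1)" for i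
    using less_mult_imp_div_less [OF that] by simp
  have e: "(a * (k + 1) + b) div (k + 1) = a" "(a * (k + 1) + b) mod (k + 1) = b" if "b \<le> k" for a b
    using that by (simp_all del: add_mult_distrib2 mult_Suc_right add: div_mult_self3)
  have r: "i mod (k + 1) \<le> k" for i
    using mod_less_divisor [of "k + 1" i] by linarith
  show ?thesis
    unfolding sum.cartesian_product
    by (rule sum.reindex_bij_witness [of _ "\<lambda>(a, b). a * (k + 1) + b" "\<lambda>i. (i div (k + 1), i mod (k + 1))"])
      (use lt d e r in \<open>auto simp del: add_mult_distrib2 mult_Suc_right\<close>)
qed

section \<open>The representations on the torus\<close>

lemma coord_scale_psi:
  assumes "b \<le> n" "i \<le> n"
  shows "coord n (\<lambda>z. c * psi n b z) i = (if i = b then c else 0)"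
proof -
  let ?d = "\<lambda>i. if i = b then c else 0"
  have "(\<lambda>z. c * psi n b z) \<in> H n"
    using assms by (intro H_scale psi_in_H)
  moreover have "(\<forall>i>n. ?d i = 0) \<and> (\<lambda>z. c * psi n b z) = (\<lambda>z. \<Sum>i\<le>n. ?d i * psi n i z)"
    using assms by (auto simp: fun_eq_iff if_distrib [of "\<lambda>u. u * _"] sum.delta cong: if_cong)
  ultimately have "coord n (\<lambda>z. c * psi n b z) = ?d"
    unfolding coord_def by (intro the1_equality psi_basis)
  then show ?thesis by simp
qed

lemma T_op_m_elt_psi:
  assumes "b \<le> n"
  shows "T_op (m_elt t) (psi n b) = (\<lambda>z. cis (t * (n / 2 - b)) * psi n b z)"
proof
  fix z :: "complex \<times> complex"
  obtain x y where z: "z = (x, y)" by (cases z)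
  have "cis (t / 2) ^ (n - b) * cis (- t / 2) ^ b = cis (t * (n / 2 - b))"
    unfolding Complex.DeMoivre cis_mult
    by (rule arg_cong [where f = cis]) (use assms in \<open>simp add: of_nat_diff field_simps\<close>)
  then show "T_op (m_elt t) (psi n b) z = cis (t * (n / 2 - b)) * psi n b z"
    by (simp add: z T_op_def psi_def lin_map_def m_elt_def power_mult_distrib mult_ac)
qed

lemma T_mat_m_elt:
  assumes "i \<le> n" "j \<le> n"
  shows "T_mat n (m_elt t) $$ (i, j) = (if i = j then cis (t * (n / 2 - j)) else 0)"
  using assms by (simp add: T_mat_def T_op_m_elt_psi coord_scale_psi)

lemma T_mat_dim [simp]: "dim_row (T_mat n k) = n + 1" "dim_col (T_mat n k) = n + 1"
  by (simp_all add: T_mat_def)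

lemma T_outer_a_elt:
  assumes "i < (n1 + 1) * (n2 + 1)" "j < (n1 + 1) * (n2 + 1)"
  shows "T_outer n1 n2 (a_elt t) $$ (i, j) = (if i = j then
    cis (t * ((n1 / 2 - real (i div (n2 + 1))) - (n2 / 2 - real (i mod (n2 + 1))))) else 0)"
proof -
  have b: "i div (n2 + 1) \<le> n1" "j div (n2 + 1) \<le> n1" "i mod (n2 + 1) \<le> n2" "j mod (n2 + 1) \<le> n2"
    using less_mult_imp_div_less [OF assms(1)] less_mult_imp_div_less [OF assms(2)]
      mod_less_divisor [of "n2 + 1" i] mod_less_divisor [of "n2 + 1" j] by linarith+
  have ij: "i = j \<longleftrightarrow> i div (n2 + 1) = j div (n2 + 1) \<and> i mod (n2 + 1) = j mod (n2 + 1)"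
    by (metis div_mult_mod_eq)
  have "T_outer n1 n2 (a_elt t) $$ (i, j) =
      T_mat n1 (m_elt t) $$ (i div (n2 + 1), j div (n2 + 1))
      * T_mat n2 (m_elt (- t)) $$ (i mod (n2 + 1), j mod (n2 + 1))"
    using assms by (simp add: T_outer_def kronecker_def a_elt_def)
  also have "\<dots> = (if i = j then
    cis (t * ((n1 / 2 - real (i div (n2 + 1))) - (n2 / 2 - real (i mod (n2 + 1))))) else 0)"
    unfolding ij using b by (auto simp: T_mat_m_elt cis_mult algebra_simps)
  finally show ?thesis .
qed

section \<open>Clebsch-Gordan coefficients of the top component\<close>

lemma rfact_of_nat [simp]: "rfact (real m) = fact m"
  by (simp add: rfact_def)

lemma rfact_0 [simp]: "rfact 0 = 1"
  by (simp add: rfact_def)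

text \<open>
  For \<open>l = l1 + l2\<close> the bound \<open>k \<le> l1 + l2 - l\<close> in Racah's sum leaves only \<open>k = 0\<close>, so that the
  coefficient is a single quotient of factorials.
\<close>

lemma clebsch_gordan_top_squared:
  assumes p: "p \<le> n" and b: "b1 \<le> p" "b2 \<le> n - p"
  shows "(clebsch_gordan (p / 2) (real (n - p) / 2) (n / 2)
      (real b1 - p / 2) (real b2 - real (n - p) / 2) (real q - n / 2))\<^sup>2
    = (if b1 + b2 = q then real (p choose b1) * real (n - p choose b2) / real (n choose q) else 0)"
proof (cases "b1 + b2 = q")
  case False
  then have "real b1 - p / 2 + (real b2 - real (n - p) / 2) \<noteq> real q - n / 2"
    using p by (auto simp: of_nat_diff field_simps simp flip: of_nat_add)
  then show ?thesis using False by (simp add: clebsch_gordan_def)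
next
  case True
  define m where "m = n - p"
  define c1 where "c1 = p - b1"
  define c2 where "c2 = m - b2"
  have n: "n = p + m" and pm: "p = b1 + c1" "m = b2 + c2"
    using p b by (simp_all add: m_def c1_def c2_def)
  have q: "q = b1 + b2" using True by simp
  have S: "{k :: nat. real k \<le> p / 2 + m / 2 - n / 2 \<and> real k \<le> p / 2 - (real b1 - p / 2)
      \<and> real k \<le> m / 2 + (real b2 - m / 2) \<and> 0 \<le> n / 2 - m / 2 + (real b1 - p / 2) + real k
      \<and> 0 \<le> n / 2 - p / 2 - (real b2 - m / 2) + real k} = {0}"
    using n pm by (auto simp: field_simps)
  have e: "2 * (n / 2) + 1 = real (n + 1)" "n / 2 + p / 2 - m / 2 = real p"
    "n / 2 - p / 2 + m / 2 = real m" "p / 2 + m / 2 - n / 2 = real 0"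
    "p / 2 + m / 2 + n / 2 + 1 = real (n + 1)"
    "n / 2 + (q - n / 2) = real q" "n / 2 - (q - n / 2) = real (n - q)"
    "p / 2 + (b1 - p / 2) = real b1" "p / 2 - (b1 - p / 2) = real c1"
    "m / 2 + (b2 - m / 2) = real b2" "m / 2 - (b2 - m / 2) = real c2"
    "n / 2 - m / 2 + (b1 - p / 2) = real b1" "n / 2 - p / 2 - (b2 - m / 2) = real c2"
    "p / 2 + m / 2 - n / 2 - real (0::nat) = real 0"
    by (auto simp: n pm q field_simps)
  have w: "real b1 - p / 2 + (real b2 - m / 2) = real q - n / 2"
    by (simp add: n q field_simps)
  have "clebsch_gordan (p / 2) (m / 2) (n / 2) (real b1 - p / 2) (real b2 - m / 2) (real q - n / 2)
    = sqrt (real (n + 1) * fact p * fact m * fact 0 / fact (n + 1))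
      * sqrt (fact q * fact (n - q) * fact b1 * fact c1 * fact b2 * fact c2)
      * (1 / (fact c1 * fact b2 * fact b1 * fact c2))"
    unfolding clebsch_gordan_def S using w by (simp only: e rfact_of_nat if_True sum.insert
      finite.emptyI empty_iff not_False_eq_True sum.empty fact_0 power_0 diff_0_right add_0_right
      of_nat_0 mult_1 mult_1_right simp_thms rfact_0)
  then have "(clebsch_gordan (p / 2) (m / 2) (n / 2) (real b1 - p / 2) (real b2 - m / 2) (real q - n / 2))\<^sup>2
    = (real (n + 1) * fact p * fact m / fact (n + 1))
      * (fact q * fact (n - q) * fact b1 * fact c1 * fact b2 * fact c2)
      * (1 / (fact c1 * fact b2 * fact b1 * fact c2))\<^sup>2"
    by (simp add: power_mult_distrib power_divide)
  also have "\<dots> = real (p choose b1) * real (m choose b2) / real (n choose q)"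
  proof -
    have "real (p choose b1) = fact p / (fact b1 * fact c1)" "real (m choose b2) = fact m / (fact b2 * fact c2)"
      "real (n choose q) = fact n / (fact q * fact (n - q))"
      using binomial_fact [of b1 p] binomial_fact [of b2 m] binomial_fact [of q n] pm n q by simp_all
    moreover have "real (n + 1) * fact p * fact m / fact (n + 1) = fact p * fact m / (fact n :: real)"
      by (simp del: of_nat_Suc)
    ultimately show ?thesis by (simp add: power2_eq_square mult_ac)
  qed
  finally show ?thesis using True by (simp add: m_def)
qed

section \<open>The spherical function as a polynomial\<close>

text \<open>
  As a polynomial in \<open>z\<close>, this is the coefficient of \<open>s ^ q\<close> in \<open>(z + s) ^ p (1 + s z) ^ (n - p)\<close>; the terms with
  \<open>i > p\<close>, in which the exponent \<open>p - i\<close> is truncated, have coefficient \<open>0\<close>.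
\<close>

definition sph_poly :: "nat \<Rightarrow> nat \<Rightarrow> nat \<Rightarrow> complex poly" where
  "sph_poly n p q = (\<Sum>i\<le>q. monom (of_nat ((p choose i) * (n - p choose (q - i)))) (p - i + (q - i)))"

lemma poly_sph_poly:
  "poly (sph_poly n p q) z
    = (\<Sum>i\<le>q. of_nat ((p choose i) * (n - p choose (q - i))) * z ^ (p - i + (q - i)))"
  by (simp add: sph_poly_def poly_sum poly_monom)

text \<open>
  The diagonal entry is a sum over the pairs of weights \<open>b1 + b2 = q\<close> with phase
  \<open>z ^ (b2 - b1 + p - n/2)\<close>; splitting off \<open>z ^ (- n/2)\<close> leaves the nonnegative power
  \<open>z ^ ((p - b1) + b2)\<close>.
\<close>

lemma Phi_top_a_elt:
  assumes p: "p \<le> n" and q: "q \<le> n"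
  shows "Phi p (n - p) n (a_elt t) $$ (q, q)
    = cis (- (real n * t / 2)) / of_nat (n choose q) * poly (sph_poly n p q) (cis t)"
proof -
  define m where "m = n - p"
  define N where "N = (p + 1) * (m + 1)"
  let ?C = "\<lambda>b1 b2. clebsch_gordan (p / 2) (m / 2) (n / 2)
      (real b1 - p / 2) (real b2 - m / 2) (real q - n / 2)"
  let ?e = "\<lambda>b1 b2. cis (t * ((p / 2 - real b1) - (m / 2 - real b2)))"
  define B where "B = beta_mat p m n"
  define T where "T = T_outer p m (a_elt t)"
  have B: "B \<in> carrier_mat N (n + 1)" by (simp add: B_def beta_mat_def N_def)
  have T: "T \<in> carrier_mat N N" by (simp add: T_def T_outer_def kronecker_def N_def)
  have Bq: "B $$ (i, q) = of_real (?C (i div (m + 1)) (i mod (m + 1)))" if "i < N" for i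
    using that q by (simp add: B_def beta_mat_def N_def)
  have AT: "(mat_adjoint B * T) $$ (q, j) = cnj (B $$ (j, q)) * ?e (j div (m + 1)) (j mod (m + 1))"
    if "j < N" for j
  proof -
    have "(mat_adjoint B * T) $$ (q, j) = (\<Sum>i<N. cnj (B $$ (i, q)) * T $$ (i, j))"
      using B T that q by (simp add: scalar_prod_def mat_adjoint_index lessThan_atLeast0)
    also have "\<dots> = (\<Sum>i<N. if i = j then cnj (B $$ (j, q)) * ?e (j div (m + 1)) (j mod (m + 1)) else 0)"
      using that by (intro sum.cong) (auto simp: T_def T_outer_a_elt N_def)
    finally show ?thesis using that by simp
  qed
  have dim: "dim_row (mat_adjoint B * T) = n + 1" "dim_col (mat_adjoint B * T) = N"
    using B T by simp_all
  have CG: "(?C b1 b2)\<^sup>2 = (if b1 + b2 = q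
      then real (p choose b1) * real (m choose b2) / real (n choose q) else 0)"
    if "b1 \<le> p" "b2 \<le> m" for b1 b2
    using clebsch_gordan_top_squared [OF p] that unfolding m_def by blast
  have "Phi p m n (a_elt t) $$ (q, q) = (\<Sum>j<N. (mat_adjoint B * T) $$ (q, j) * B $$ (j, q))"
    unfolding Phi_def B_def [symmetric] T_def [symmetric]
    by (subst index_mult_mat(1))
      (use B dim q in \<open>auto simp: scalar_prod_def lessThan_atLeast0 simp del: index_mult_mat(1)\<close>)
  also have "\<dots> = (\<Sum>j<N. of_real ((?C (j div (m + 1)) (j mod (m + 1)))\<^sup>2) * ?e (j div (m + 1)) (j mod (m + 1)))"
    by (intro sum.cong) (auto simp: AT Bq power2_eq_square mult_ac simp del: of_real_mult simp flip: of_real_mult)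
  also have "\<dots> = (\<Sum>b1\<le>p. \<Sum>b2\<le>m. of_real ((?C b1 b2)\<^sup>2) * ?e b1 b2)"
    unfolding N_def by (rule sum_div_mod)
  also have "\<dots> = (\<Sum>b1\<le>p. \<Sum>b2\<le>m. if b1 + b2 = q then
      of_nat (p choose b1) * of_nat (m choose b2) / of_nat (n choose q) * ?e b1 b2 else 0)"
    by (intro sum.cong) (auto simp: CG simp del: of_real_power)
  also have "\<dots> = (\<Sum>b1\<le>p. if b1 \<le> q then
      of_nat (p choose b1) * of_nat (m choose (q - b1)) / of_nat (n choose q) * ?e b1 (q - b1) else 0)"
  proof (intro sum.cong refl)
    fix b1
    have "(\<Sum>b2\<le>m. if b1 + b2 = q then
        complex_of_nat (p choose b1) * of_nat (m choose b2) / of_nat (n choose q) * ?e b1 b2 else 0)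
      = (\<Sum>b2\<le>m. if b2 = q - b1 then (if b1 \<le> q then
        of_nat (p choose b1) * of_nat (m choose (q - b1)) / of_nat (n choose q) * ?e b1 (q - b1) else 0) else 0)"
      by (intro sum.cong) auto
    also have "\<dots> = (if b1 \<le> q then
        of_nat (p choose b1) * of_nat (m choose (q - b1)) / of_nat (n choose q) * ?e b1 (q - b1) else 0)"
      by auto
    finally show "(\<Sum>b2\<le>m. if b1 + b2 = q then
        complex_of_nat (p choose b1) * of_nat (m choose b2) / of_nat (n choose q) * ?e b1 b2 else 0) = \<dots>" .
  qed
  also have "\<dots> = (\<Sum>b1\<le>q.
      of_nat (p choose b1) * of_nat (m choose (q - b1)) / of_nat (n choose q) * ?e b1 (q - b1))"
    by (intro sum.mono_neutral_cong) auto
  also have "\<dots> = (\<Sum>i\<le>q. cis (- (real n * t / 2)) / of_nat (n choose q) *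
      (of_nat ((p choose i) * (m choose (q - i))) * cis t ^ (p - i + (q - i))))"
  proof (intro sum.cong refl)
    fix i assume i: "i \<in> {..q}"
    show "of_nat (p choose i) * of_nat (m choose (q - i)) / of_nat (n choose q) * ?e i (q - i)
      = cis (- (real n * t / 2)) / of_nat (n choose q) *
      (of_nat ((p choose i) * (m choose (q - i))) * cis t ^ (p - i + (q - i)))"
    proof (cases "i \<le> p")
      case True
      have "?e i (q - i) = cis (- (real n * t / 2)) * cis t ^ (p - i + (q - i))"
        unfolding Complex.DeMoivre cis_mult
        by (rule arg_cong [where f = cis]) (use True p i in \<open>simp add: m_def of_nat_diff field_simps\<close>)
      then show ?thesis by simp
    qed simp
  qed
  also have "\<dots> = cis (- (real n * t / 2)) / of_nat (n choose q) * poly (sph_poly n p q) (cis t)"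
    by (simp add: poly_sph_poly sum_distrib_left m_def)
  finally show ?thesis by (simp add: m_def)
qed

lemma sph_poly_eq_coeff:
  "poly (sph_poly n p q) z = coeff ([:z, 1:] ^ p * [:1, z:] ^ (n - p)) q"
proof -
  have lin: "coeff ([:a, b:] ^ m) i = of_nat (m choose i) * b ^ i * a ^ (m - i)" for a b :: complex and m i
  proof (cases "i \<le> m")
    case False
    have "degree ([:a, b:] ^ m) \<le> degree [:a, b:] * m" by (rule degree_power_le)
    also have "\<dots> \<le> m" by simp
    finally show ?thesis using False by (simp add: coeff_eq_0)
  qed (rule coeff_linear_poly_power)
  show ?thesis
    unfolding poly_sph_poly coeff_mult lin power_add by (simp add: mult_ac)
qed

text \<open>
  Exchanging the two factors of the generating function amounts to reversing its coefficients in \<open>s\<close>.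
\<close>

lemma sph_poly_reflect:
  assumes "p \<le> n" "q \<le> n" "z \<noteq> 0"
  shows "poly (sph_poly n (n - p) q) z = poly (sph_poly n p (n - q)) z"
proof -
  let ?G = "[:z, 1:] ^ p * [:1, z:] ^ (n - p)"
  have "reflect_poly ?G = [:1, z:] ^ p * [:z, 1:] ^ (n - p)"
    using assms(3) by (simp add: reflect_poly_mult reflect_poly_power reflect_poly_pCons)
  moreover have "degree ?G = n"
    using assms by (simp add: degree_mult_eq degree_power_eq)
  ultimately have "coeff ([:1, z:] ^ p * [:z, 1:] ^ (n - p)) q = coeff ?G (n - q)"
    using assms(2) coeff_reflect_poly [of ?G q] by simp
  then show ?thesis
    using assms by (simp add: sph_poly_eq_coeff mult.commute)
qed

text \<open>
  On the unit circle \<open>1/z\<close> is the conjugate of \<open>z\<close>, so this gives the complex conjugate of a spherical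
  function as a polynomial in \<open>z\<close> again. In the sum it is the exchange of the two weights,
  \<open>i \<mapsto> q - i\<close>.
\<close>

lemma sph_poly_inverse:
  assumes "p \<le> n" "z \<noteq> 0"
  shows "z ^ n * poly (sph_poly n p q) (inverse z) = poly (sph_poly n (n - p) q) z"
proof -
  have "z ^ n * poly (sph_poly n p q) (inverse z)
    = (\<Sum>i\<le>q. of_nat ((p choose i) * (n - p choose (q - i))) * (z ^ n * inverse z ^ (p - i + (q - i))))"
    by (simp add: poly_sph_poly sum_distrib_left mult_ac)
  also have "\<dots> = (\<Sum>i\<le>q. of_nat ((n - p choose i) * (p choose (q - i))) * z ^ (n - p - i + (q - i)))"
  proof (rule sum.reindex_bij_witness [of _ "\<lambda>i. q - i" "\<lambda>i. q - i"])
    fix i assume i: "i \<in> {..q}"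
    show "of_nat ((n - p choose (q - i)) * (p choose (q - (q - i)))) * z ^ (n - p - (q - i) + (q - (q - i)))
      = of_nat ((p choose i) * (n - p choose (q - i))) * (z ^ n * inverse z ^ (p - i + (q - i)))"
    proof (cases "i \<le> p \<and> q - i \<le> n - p")
      case True
      have "n = (n - p - (q - i) + i) + (p - i + (q - i))" using True assms i by auto
      then have "z ^ n = z ^ (n - p - (q - i) + i) * z ^ (p - i + (q - i))"
        by (metis power_add)
      then have "z ^ n * inverse z ^ (p - i + (q - i)) = z ^ (n - p - (q - i) + i)"
        using assms(2) by (simp add: power_inverse)
      then show ?thesis using i by (simp add: mult_ac)
    next
      case False
      then show ?thesis using i by (auto simp: not_le)
    qed
  qed auto
  also have "\<dots> = poly (sph_poly n (n - p) q) z"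
    using assms(1) by (simp add: poly_sph_poly)
  finally show ?thesis .
qed

lemma coeff_sph_poly:
  "coeff (sph_poly n p q) d = (\<Sum>i\<le>q. if p - i + (q - i) = d
    then of_nat ((p choose i) * (n - p choose (q - i))) else 0)"
  by (simp add: sph_poly_def coeff_sum del: of_nat_mult)

text \<open>
  Modulo \<open>z ^ 2\<close> the generating function is \<open>s ^ p + z (p s ^ (p - 1) + (n - p) s ^ (p + 1))\<close>.
\<close>

lemma coeff_sph_poly_0: "coeff (sph_poly n p q) 0 = (if p = q then 1 else 0)"
proof -
  have "coeff (sph_poly n p q) 0 = (\<Sum>i\<le>q. if i = q then (if p = q then 1 else 0) else 0)"
    unfolding coeff_sph_poly by (intro sum.cong) auto
  then show ?thesis by simp
qed

lemma coeff_sph_poly_1: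
  "coeff (sph_poly n p q) 1 = of_nat ((if p = q + 1 then p else 0) + (if q = p + 1 then n - p else 0))"
proof (cases q)
  case 0
  then show ?thesis by (auto simp: coeff_sph_poly)
next
  case (Suc m)
  let ?f = "\<lambda>i. if p - i + (q - i) = 1 then complex_of_nat ((p choose i) * (n - p choose (q - i))) else 0"
  have "coeff (sph_poly n p q) 1 = (\<Sum>i\<le>m. ?f i) + ?f q"
    by (simp only: coeff_sph_poly Suc sum.atMost_Suc)
  also have "(\<Sum>i\<le>m. ?f i) = (\<Sum>i\<le>m. if i = m then (if q = p + 1 then of_nat (n - p) else 0) else 0)"
    using Suc by (intro sum.cong) (auto simp: not_less_eq)
  finally have "coeff (sph_poly n p q) 1 = (if q = p + 1 then of_nat (n - p) else 0)
      + (if p - q = 1 then of_nat (p choose q) else 0)"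
    by simp
  moreover have "p - q = 1 \<longleftrightarrow> p = q + 1" by auto
  ultimately show ?thesis by auto
qed

section \<open>Products of spherical functions\<close>

text \<open>These are the entries of \<open>z ^ n v\<close>; the index \<open>n - r\<close> comes from the complex conjugate.\<close>

definition v_poly :: "nat \<Rightarrow> nat \<Rightarrow> nat \<Rightarrow> complex poly" where
  "v_poly n p r = (\<Sum>q\<le>n. smult (1 / (of_nat (n choose q))\<^sup>2) (sph_poly n p q * sph_poly n (n - r) q))"

lemma Phi0_a_elt:
  assumes "p \<le> n" "q \<le> n"
  shows "Phi0 n (a_elt t) $$ (p, q)
    = cis (- (real n * t / 2)) / of_nat (n choose q) * poly (sph_poly n p q) (cis t)"
  using assms by (simp add: Phi0_def Phi_top_a_elt)

lemma cnj_Phi0_a_elt: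
  assumes "p \<le> n" "q \<le> n"
  shows "cnj (Phi0 n (a_elt t) $$ (p, q)) = Phi0 n (a_elt t) $$ (n - p, q)"
proof -
  have c: "cnj (poly (sph_poly n p q) z) = poly (sph_poly n p q) (cnj z)" for z
    by (simp add: poly_sph_poly)
  have "cnj (Phi0 n (a_elt t) $$ (p, q))
    = cis (real n * t / 2) / of_nat (n choose q) * poly (sph_poly n p q) (inverse (cis t))"
    using assms by (simp add: Phi0_a_elt c cis_cnj cis_inverse)
  also have "cis (real n * t / 2) = cis (- (real n * t / 2)) * cis t ^ n"
    unfolding Complex.DeMoivre cis_mult by (rule arg_cong [where f = cis]) simp
  also have "cis (- (real n * t / 2)) * cis t ^ n / of_nat (n choose q) * poly (sph_poly n p q) (inverse (cis t))
    = cis (- (real n * t / 2)) / of_nat (n choose q) * poly (sph_poly n (n - p) q) (cis t)"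
    using sph_poly_inverse [OF assms(1), of "cis t" q] by simp
  finally show ?thesis using assms by (simp add: Phi0_a_elt)
qed

lemma v_mat_carrier: "v_mat n a \<in> carrier_mat (n + 1) (n + 1)"
  by (intro carrier_matI) (simp_all add: v_mat_def Phi0_def)

lemma v_mat_a_elt:
  assumes "p \<le> n" "r \<le> n"
  shows "v_mat n (a_elt t) $$ (p, r) = cis (- (real n * t)) * poly (v_poly n p r) (cis t)"
proof -
  let ?P = "Phi0 n (a_elt t)"
  have P: "?P \<in> carrier_mat (n + 1) (n + 1)" by (simp add: Phi0_def)
  then have P': "mat_adjoint ?P \<in> carrier_mat (n + 1) (n + 1)" by (intro carrier_matI) (simp_all add: carrier_matD)
  have "v_mat n (a_elt t) $$ (p, r) = (\<Sum>q\<le>n. ?P $$ (p, q) * ?P $$ (n - r, q))"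
    unfolding v_mat_def index_mult_mat_sum [OF P P' assms]
  proof (intro sum.cong refl)
    fix q assume "q \<in> {..n}"
    then have "mat_adjoint ?P $$ (q, r) = ?P $$ (n - r, q)"
      using P assms cnj_Phi0_a_elt [of r n q t] by (simp add: mat_adjoint_index)
    then show "?P $$ (p, q) * mat_adjoint ?P $$ (q, r) = ?P $$ (p, q) * ?P $$ (n - r, q)"
      by simp
  qed
  also have "\<dots> = (\<Sum>q\<le>n. cis (- (real n * t)) *
      (1 / (of_nat (n choose q))\<^sup>2 * (poly (sph_poly n p q) (cis t) * poly (sph_poly n (n - r) q) (cis t))))"
  proof (intro sum.cong refl)
    fix q assume q: "q \<in> {..n}"
    have qn: "q \<le> n" "n - r \<le> n" using q by auto
    have "cis (- (real n * t)) = cis (- (real n * t / 2)) * cis (- (real n * t / 2))"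
      by (simp add: cis_mult mult.commute)
    then show "?P $$ (p, q) * ?P $$ (n - r, q) = cis (- (real n * t)) *
      (1 / (of_nat (n choose q))\<^sup>2 * (poly (sph_poly n p q) (cis t) * poly (sph_poly n (n - r) q) (cis t)))"
      by (simp only: Phi0_a_elt [OF assms(1) qn(1)] Phi0_a_elt [OF qn(2) qn(1)])
        (simp add: power2_eq_square)
  qed
  also have "\<dots> = cis (- (real n * t)) * poly (v_poly n p r) (cis t)"
    by (simp add: v_poly_def poly_sum sum_distrib_left)
  finally show ?thesis .
qed

text \<open>
  This says that \<open>v\<close> commutes with \<open>J\<close>: reversing \<open>q\<close> in the sum over the columns of the spherical
  function flips both row indices, and the weights \<open>1 / (n choose q) ^ 2\<close> are symmetric.
\<close>

lemma poly_v_poly_flip: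
  assumes "p \<le> n" "r \<le> n" "z \<noteq> 0"
  shows "poly (v_poly n (n - p) r) z = poly (v_poly n p (n - r)) z"
proof -
  let ?f = "\<lambda>q. 1 / (of_nat (n choose q))\<^sup>2 * (poly (sph_poly n p q) z * poly (sph_poly n r q) z)"
  have "poly (v_poly n (n - p) r) z = (\<Sum>q\<le>n. ?f (n - q))"
    unfolding v_poly_def poly_sum using assms
    by (intro sum.cong) (auto simp: sph_poly_reflect binomial_symmetric [symmetric])
  also have "\<dots> = (\<Sum>q\<le>n. ?f q)"
    by (rule sum.reindex_bij_witness [of _ "\<lambda>q. n - q" "\<lambda>q. n - q"]) auto
  also have "\<dots> = poly (v_poly n p (n - r)) z"
    using assms by (simp add: v_poly_def poly_sum)
  finally show ?thesis .
qed

lemma coeff_v_poly_0: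
  assumes "p \<le> n" "r \<le> n"
  shows "coeff (v_poly n p r) 0 = (if p = n - r then 1 / (of_nat (n choose p))\<^sup>2 else 0)"
proof -
  have "coeff (v_poly n p r) 0
    = (\<Sum>q\<le>n. if q = p then (if p = n - r then 1 / (of_nat (n choose p))\<^sup>2 else 0) else 0)"
    unfolding v_poly_def coeff_sum
    by (intro sum.cong) (auto simp: coeff_mult_0 coeff_sph_poly_0)
  then show ?thesis using assms by simp
qed

text \<open>
  The two summands in \<open>coeff (f * g) 1 = coeff f 0 * coeff g 1 + coeff f 1 * coeff g 0\<close> are
  supported at \<open>q = p\<close> and \<open>q = n - r\<close>. All contributions are nonnegative, so nothing cancels.
\<close>

lemma coeff_v_poly_1:
  assumes "p \<le> n" "r \<le> n"
  shows "coeff (v_poly n p r) 1 = 0 \<longleftrightarrow> p \<noteq> n - r + 1 \<and> n - r \<noteq> p + 1"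
proof -
  define s where "s = n - r"
  have s: "s \<le> n" using assms by (simp add: s_def)
  have cm: "coeff (f * g) 1 = coeff f 0 * coeff g 1 + coeff f 1 * coeff g 0" for f g :: "complex poly"
    by (simp add: coeff_mult)
  define c :: "nat \<Rightarrow> real" where "c q = 1 / (real (n choose q))\<^sup>2" for q
  \<comment> \<open>the coefficient of \<open>z ^ 1\<close> in \<open>sph_poly n a q\<close>\<close>
  define e :: "nat \<Rightarrow> nat \<Rightarrow> nat" where
    "e a q = (if a = q + 1 then a else 0) + (if q = a + 1 then n - a else 0)" for a q
  have "coeff (v_poly n p r) 1 = (\<Sum>q\<le>n. (if q = p then of_real (c p * e s p) else 0)
      + (if q = s then of_real (c s * e p s) else 0))"
    unfolding v_poly_def coeff_sum s_def [symmetric]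
  proof (intro sum.cong refl)
    fix q
    have "coeff (sph_poly n p q * sph_poly n s q) 1
        = (if q = p then of_nat (e s q) else 0) + (if q = s then of_nat (e p q) else 0)"
      unfolding cm coeff_sph_poly_0 coeff_sph_poly_1 e_def [symmetric] by simp
    then show "coeff (smult (1 / (of_nat (n choose q))\<^sup>2) (sph_poly n p q * sph_poly n s q)) 1
        = (if q = p then of_real (c p * e s p) else 0) + (if q = s then of_real (c s * e p s) else 0)"
      unfolding coeff_smult by (simp add: c_def algebra_simps)
  qed
  also have "\<dots> = of_real (c p * e s p + c s * e p s)"
    using assms s by (simp add: sum.distrib)
  finally have E: "coeff (v_poly n p r) 1 = of_real (c p * e s p + c s * e p s)" .
  have "c p > 0" "c s > 0" using assms s by (simp_all add: c_def)
  moreover have "e s p \<ge> 0" "e p s \<ge> 0" by simp_all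
  ultimately have "c p * e s p + c s * e p s = 0 \<longleftrightarrow> e s p = 0 \<and> e p s = 0"
    by (simp add: add_nonneg_eq_0_iff)
  also have "\<dots> \<longleftrightarrow> p \<noteq> s + 1 \<and> s \<noteq> p + 1"
    using assms s by (auto simp: e_def)
  finally show ?thesis unfolding E of_real_eq_0_iff s_def .
qed

section \<open>The commutant\<close>

lemma J_mat_carrier: "J_mat n \<in> carrier_mat (n + 1) (n + 1)"
  by (simp add: J_mat_def)

lemma span_subset_commutant_v:
  "\<alpha> \<cdot>\<^sub>m 1\<^sub>m (n + 1) + \<beta> \<cdot>\<^sub>m J_mat n \<in> commutant n {v_mat n a | a. a \<in> A_star}"
proof -
  define Y where "Y = \<alpha> \<cdot>\<^sub>m 1\<^sub>m (n + 1) + \<beta> \<cdot>\<^sub>m J_mat n"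
  have Y: "Y \<in> carrier_mat (n + 1) (n + 1)"
    unfolding Y_def by (intro add_carrier_mat smult_carrier_mat J_mat_carrier)
  have Yi: "Y $$ (i, j) = (if i = j then \<alpha> else 0) + (if i = n - j then \<beta> else 0)"
    if "i \<le> n" "j \<le> n" for i j
    using that by (simp add: Y_def J_mat_def)
  have "v_mat n (a_elt t) * Y = Y * v_mat n (a_elt t)" for t
  proof -
    let ?v = "v_mat n (a_elt t)"
    have "(?v * Y) $$ (p, r) = (Y * ?v) $$ (p, r)" if pr: "p \<le> n" "r \<le> n" for p r
    proof -
      have "(?v * Y) $$ (p, r) = (\<Sum>k\<le>n. (if k = r then ?v $$ (p, r) * \<alpha> else 0)
          + (if k = n - r then ?v $$ (p, n - r) * \<beta> else 0))"
        unfolding index_mult_mat_sum [OF v_mat_carrier Y pr]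
        using pr by (intro sum.cong) (auto simp: Yi algebra_simps)
      also have "\<dots> = ?v $$ (p, r) * \<alpha> + ?v $$ (p, n - r) * \<beta>"
        using pr by (simp add: sum.distrib)
      also have "?v $$ (p, n - r) = ?v $$ (n - p, r)"
        using pr by (simp add: v_mat_a_elt poly_v_poly_flip)
      also have "?v $$ (p, r) * \<alpha> + ?v $$ (n - p, r) * \<beta>
        = (\<Sum>k\<le>n. (if k = p then ?v $$ (p, r) * \<alpha> else 0)
          + (if k = n - p then ?v $$ (n - p, r) * \<beta> else 0))"
        using pr by (simp add: sum.distrib)
      also have "\<dots> = (Y * ?v) $$ (p, r)"
      proof -
        have "(if k = p then ?v $$ (p, r) * \<alpha> else 0) + (if k = n - p then ?v $$ (n - p, r) * \<beta> else 0)
          = Y $$ (p, k) * ?v $$ (k, r)" if k: "k \<le> n" for k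
        proof -
          have "p = n - k \<longleftrightarrow> k = n - p" using k pr by linarith
          then have "Y $$ (p, k) = (if k = p then \<alpha> else 0) + (if k = n - p then \<beta> else 0)"
            using Yi [OF pr(1) k] by metis
          then show ?thesis by (simp add: distrib_right mult.commute)
        qed
        then show ?thesis
          unfolding index_mult_mat_sum [OF Y v_mat_carrier pr] by (intro sum.cong) auto
      qed
      finally show ?thesis .
    qed
    then show ?thesis
      using Y v_mat_carrier [of n "a_elt t"]
      by (intro eq_matI) (auto simp del: index_mult_mat(1))
  qed
  then show ?thesis
    using Y unfolding commutant_def A_star_def Y_def [symmetric] by blast
qed

lemma commutant_v_subset_V:
  "commutant n {v_mat n a | a. a \<in> A_star} \<subseteq> commutant n {V_mat n t | t. 0 \<le> t \<and> t < 4 * pi}"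
proof
  fix Y assume Y: "Y \<in> commutant n {v_mat n a | a. a \<in> A_star}"
  have "V_mat n t * Y = Y * V_mat n t" if "0 \<le> t" "t < 4 * pi" for t
  proof -
    have "v_mat n (a_elt t) \<in> {v_mat n a | a. a \<in> A_star}"
      using that unfolding A_star_def by blast
    then have "v_mat n (a_elt t) * Y = Y * v_mat n (a_elt t)"
      using Y unfolding commutant_def by blast
    moreover have "Y \<in> carrier_mat (n + 1) (n + 1)" using Y by (simp add: commutant_def)
    ultimately show ?thesis
      unfolding V_mat_def
      by (metis mult_smult_assoc_mat mult_smult_distrib v_mat_carrier)
  qed
  then show "Y \<in> commutant n {V_mat n t | t. 0 \<le> t \<and> t < 4 * pi}"
    using Y by (auto simp: commutant_def)
qed

text \<open>
  The points \<open>cis t\<close> with \<open>0 < t < \<pi>\<close> are infinitely many, and \<open>sin t\<close> can be cancelled there; a polynomial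
  that vanishes at all of them is zero.
\<close>

lemma commutant_V_coeff:
  assumes Y: "Y \<in> commutant n {V_mat n t | t. 0 \<le> t \<and> t < 4 * pi}" and pr: "p \<le> n" "r \<le> n"
  shows "(\<Sum>k\<le>n. coeff (v_poly n p k) d * Y $$ (k, r)) = (\<Sum>k\<le>n. Y $$ (p, k) * coeff (v_poly n k r) d)"
proof -
  define P where "P = (\<Sum>k\<le>n. smult (Y $$ (k, r)) (v_poly n p k) - smult (Y $$ (p, k)) (v_poly n k r))"
  have Yc: "Y \<in> carrier_mat (n + 1) (n + 1)" using Y by (simp add: commutant_def)
  have "poly P (cis t) = 0" if t: "0 < t" "t < pi" for t
  proof -
    let ?v = "v_mat n (a_elt t)"
    have s: "complex_of_real ((sin t)\<^sup>2) \<noteq> 0"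
      using sin_gt_zero [OF t] by simp
    have "V_mat n t \<in> {V_mat n t | t. 0 \<le> t \<and> t < 4 * pi}"
      using t by fastforce
    then have "V_mat n t * Y = Y * V_mat n t"
      using Y unfolding commutant_def by blast
    then have "complex_of_real ((sin t)\<^sup>2) \<cdot>\<^sub>m (?v * Y) = complex_of_real ((sin t)\<^sup>2) \<cdot>\<^sub>m (Y * ?v)"
      unfolding V_mat_def
      by (metis mult_smult_assoc_mat mult_smult_distrib v_mat_carrier Yc)
    then have "(complex_of_real ((sin t)\<^sup>2) \<cdot>\<^sub>m (?v * Y)) $$ (p, r)
        = (complex_of_real ((sin t)\<^sup>2) \<cdot>\<^sub>m (Y * ?v)) $$ (p, r)"
      by simp
    then have "(?v * Y) $$ (p, r) = (Y * ?v) $$ (p, r)"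
      using s Yc v_mat_carrier [of n "a_elt t"] pr
      by (simp del: index_mult_mat(1) of_real_power)
    then have "cis (- (real n * t)) * poly P (cis t) = 0"
      unfolding index_mult_mat_sum [OF v_mat_carrier Yc pr] index_mult_mat_sum [OF Yc v_mat_carrier pr]
      using pr by (simp add: v_mat_a_elt P_def poly_sum sum_distrib_left sum_subtractf algebra_simps)
    then show ?thesis by simp
  qed
  then have "cis ` {0<..<pi} \<subseteq> {z. poly P z = 0}" by auto
  moreover have "inj_on cis {0<..<pi}"
    by (rule inj_onI) (metis cis.sel(1) cos_inj_pi greaterThanLessThan_iff less_eq_real_def)
  then have "infinite (cis ` {0<..<pi})"
    using finite_imageD infinite_Ioo [OF pi_gt_zero] by blast
  ultimately have "P = 0"
    using poly_roots_finite finite_subset by blast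
  then have "coeff P d = 0" by simp
  then show ?thesis
    by (simp add: P_def coeff_sum sum_subtractf mult.commute)
qed

text \<open>
  Comparing \<open>D J Y = Y D J\<close> at an entry and at the opposite one gives \<open>D a x = D b y\<close> and \<open>D a y = D b x\<close>, whose
  difference is \<open>(D a + D b) (x - y) = 0\<close>. Positivity of \<open>D\<close> then gives \<open>x = y\<close>, that is, the first claim
  \<open>J Y = Y J\<close>; the second is \<open>(D p - D r) Y (p, r) = 0\<close>.
\<close>

lemma commutant_V_lowest:
  assumes Y: "Y \<in> commutant n {V_mat n t | t. 0 \<le> t \<and> t < 4 * pi}" and pr: "p \<le> n" "r \<le> n"
  shows "Y $$ (n - p, r) = Y $$ (p, n - r)"
    and "n choose p \<noteq> n choose r \<Longrightarrow> Y $$ (p, r) = 0"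
proof -
  define D :: "nat \<Rightarrow> real" where "D a = 1 / (real (n choose a))\<^sup>2" for a
  have D: "D a > 0" "D (n - a) = D a" if "a \<le> n" for a
    using that by (simp_all add: D_def binomial_symmetric [symmetric])
  have eq: "D a * Y $$ (n - a, b) = Y $$ (a, n - b) * D b" if ab: "a \<le> n" "b \<le> n" for a b
  proof -
    have A: "coeff (v_poly n a k) 0 = (if k = n - a then of_real (D a) else 0)"
      "coeff (v_poly n k b) 0 = (if k = n - b then of_real (D b) else 0)" if "k \<le> n" for k
      using ab that binomial_symmetric [of b n]
      by (auto simp: coeff_v_poly_0 D_def)
    show ?thesis
      using commutant_V_coeff [OF Y ab, of 0] ab
      by (simp add: A if_distrib [of "\<lambda>u. u * _"] if_distrib [of "\<lambda>u. _ * u"] cong: if_cong)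
  qed
  have sym: "Y $$ (n - a, b) = Y $$ (a, n - b)" if ab: "a \<le> n" "b \<le> n" for a b
  proof -
    have "D a * Y $$ (n - a, b) = D b * Y $$ (a, n - b)"
      "D a * Y $$ (a, n - b) = D b * Y $$ (n - a, b)"
      using eq [OF ab] eq [of "n - a" "n - b"] ab D by (simp_all add: mult.commute)
    then have "complex_of_real (D a + D b) * (Y $$ (n - a, b) - Y $$ (a, n - b)) = 0"
      by (simp add: algebra_simps)
    moreover have "D a + D b > 0" using D ab by (simp add: add_pos_pos)
    ultimately show ?thesis by (simp del: of_real_add)
  qed
  show "Y $$ (n - p, r) = Y $$ (p, n - r)" using pr by (rule sym)
  assume "n choose p \<noteq> n choose r"
  then have ne: "D p \<noteq> D r" using pr by (simp add: D_def)
  have "D (n - p) * Y $$ (p, r) = D r * Y $$ (p, r)"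
    using eq [of "n - p" r] sym [of "n - p" r] pr by (simp add: mult.commute)
  then show "Y $$ (p, r) = 0" using D pr ne by simp
qed

text \<open>
  If \<open>A\<close> is the coefficient of \<open>z ^ 1\<close> and row \<open>m\<close> of \<open>Y\<close> vanishes, then so does row \<open>m\<close> of
  \<open>A Y = Y A\<close>. In row \<open>m\<close>, \<open>A\<close> has its nonzero entries in the columns \<open>n - m + 1\<close> and \<open>n - m - 1\<close>. The
  corresponding rows of \<open>Y\<close> are the mirror images of rows \<open>m - 1\<close> and \<open>m + 1\<close> under \<open>J\<close>; the former
  vanishes by induction, so the latter does.
\<close>

lemma commutant_V_first_row:
  assumes Y: "Y \<in> commutant n {V_mat n t | t. 0 \<le> t \<and> t < 4 * pi}"
    and row: "\<And>r. r \<le> n \<Longrightarrow> Y $$ (0, r) = 0"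
    and "p \<le> n" "r \<le> n"
  shows "Y $$ (p, r) = 0"
  using \<open>p \<le> n\<close> \<open>r \<le> n\<close>
proof (induction p arbitrary: r rule: less_induct)
  case (less p)
  show ?case
  proof (cases p)
    case 0
    then show ?thesis using row less by simp
  next
    case (Suc m)
    have n: "m < n" "n - r \<le> n" using Suc less by auto
    let ?w = "coeff (v_poly n m (n - p)) 1"
    have E: "coeff (v_poly n m k) 1 * Y $$ (k, n - r) = (if k = n - p then ?w * Y $$ (n - p, n - r) else 0)"
      if k: "k \<le> n" for k
    proof (cases "m = n - k + 1")
      case True
      then have "Y $$ (n - k, r) = 0" using less Suc by simp
      then show ?thesis
        using commutant_V_lowest(1) [OF Y, of "n - k" "n - r"] k less True Suc by auto
    next
      case False
      show ?thesis
      proof (cases "k = n - p")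
        case neq: False
        then have "n - k \<noteq> m + 1" using k Suc by auto
        then have "coeff (v_poly n m k) 1 = 0"
          using coeff_v_poly_1 [of m n k] False k n by simp
        then show ?thesis using neq by simp
      qed simp
    qed
    have "(\<Sum>k\<le>n. coeff (v_poly n m k) 1 * Y $$ (k, n - r))
        = (\<Sum>k\<le>n. if k = n - p then ?w * Y $$ (n - p, n - r) else 0)"
      by (intro sum.cong refl E) simp
    then have "(\<Sum>k\<le>n. coeff (v_poly n m k) 1 * Y $$ (k, n - r)) = ?w * Y $$ (n - p, n - r)"
      by simp
    moreover have "(\<Sum>k\<le>n. Y $$ (m, k) * coeff (v_poly n k (n - r)) 1) = 0"
      using less.IH [of m] Suc n by (intro sum.neutral) auto
    moreover have "?w \<noteq> 0"
      using Suc less by (subst coeff_v_poly_1) auto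
    ultimately have "Y $$ (n - p, n - r) = 0"
      using commutant_V_coeff [OF Y, of m "n - r" 1] n by simp
    then show ?thesis
      using commutant_V_lowest(1) [OF Y, of p "n - r"] less by simp
  qed
qed

lemma commutant_diff:
  assumes S: "S \<subseteq> carrier_mat (n + 1) (n + 1)" and "Y \<in> commutant n S" "Z \<in> commutant n S"
  shows "Y - Z \<in> commutant n S"
proof -
  have c: "Y \<in> carrier_mat (n + 1) (n + 1)" "Z \<in> carrier_mat (n + 1) (n + 1)"
    using assms by (simp_all add: commutant_def)
  have "A * (Y - Z) = (Y - Z) * A" if "A \<in> S" for A
  proof -
    have A: "A \<in> carrier_mat (n + 1) (n + 1)" "A * Y = Y * A" "A * Z = Z * A"
      using that assms by (auto simp: commutant_def)
    then show ?thesis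
      using c by (simp add: mult_minus_distrib_mat minus_mult_distrib_mat)
  qed
  then show ?thesis using c unfolding commutant_def by (blast intro: minus_carrier_mat)
qed

lemma commutant_V_subset_span:
  assumes Y: "Y \<in> commutant n {V_mat n t | t. 0 \<le> t \<and> t < 4 * pi}"
  shows "\<exists>\<alpha> \<beta>. Y = \<alpha> \<cdot>\<^sub>m 1\<^sub>m (n + 1) + \<beta> \<cdot>\<^sub>m J_mat n"
proof -
  define \<alpha> where "\<alpha> = Y $$ (0, 0)"
  \<comment> \<open>for \<open>n = 0\<close> the two corners coincide, as do \<open>I\<close> and \<open>J\<close>\<close>
  define \<beta> where "\<beta> = (if n = 0 then 0 else Y $$ (0, n))"
  define S where "S = \<alpha> \<cdot>\<^sub>m 1\<^sub>m (n + 1) + \<beta> \<cdot>\<^sub>m J_mat n"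
  have Yc: "Y \<in> carrier_mat (n + 1) (n + 1)" using Y by (simp add: commutant_def)
  have Sc: "S \<in> carrier_mat (n + 1) (n + 1)"
    unfolding S_def by (intro add_carrier_mat smult_carrier_mat J_mat_carrier)
  have "S \<in> commutant n {V_mat n t | t. 0 \<le> t \<and> t < 4 * pi}"
    unfolding S_def using span_subset_commutant_v commutant_v_subset_V by blast
  moreover have "{V_mat n t | t. 0 \<le> t \<and> t < 4 * pi} \<subseteq> carrier_mat (n + 1) (n + 1)"
    unfolding V_mat_def using v_mat_carrier by (blast intro: smult_carrier_mat)
  ultimately have Z: "Y - S \<in> commutant n {V_mat n t | t. 0 \<le> t \<and> t < 4 * pi}"
    using Y by (intro commutant_diff)
  have row: "(Y - S) $$ (0, r) = 0" if r: "r \<le> n" for r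
  proof (cases "r = 0 \<or> r = n")
    case True
    then show ?thesis using Yc Sc by (auto simp: S_def \<alpha>_def \<beta>_def J_mat_def)
  next
    case False
    then obtain m k where mk: "n = Suc m" "r = Suc k" "k < m"
      using r by (cases n; cases r) auto
    then have "0 < m choose k" "0 < m choose Suc k" by simp_all
    moreover have "n choose r = (m choose k) + (m choose Suc k)" using mk by simp
    ultimately have "n choose r > 1" by linarith
    then have "Y $$ (0, r) = 0"
      using commutant_V_lowest(2) [OF Y, of 0 r] r by simp
    then show ?thesis using False r Yc Sc by (auto simp: S_def J_mat_def)
  qed
  have "Y = S"
  proof (rule eq_matI)
    fix i j assume "i < dim_row S" "j < dim_col S"
    then have ij: "i \<le> n" "j \<le> n" using Sc by auto
    have "(Y - S) $$ (i, j) = 0"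
      using commutant_V_first_row [OF Z row] ij by blast
    then show "Y $$ (i, j) = S $$ (i, j)" using Yc Sc ij by simp
  qed (use Yc Sc in auto)
  then show ?thesis unfolding S_def by blast
qed

theorem proposition5p5:
  fixes n :: nat
  shows "commutant n {V_mat n t | t. 0 \<le> t \<and> t < 4 * pi} = commutant n {v_mat n a | a. a \<in> A_star}
    \<and> commutant n {V_mat n t | t. 0 \<le> t \<and> t < 4 * pi}
        = {\<alpha> \<cdot>\<^sub>m 1\<^sub>m (n + 1) + \<beta> \<cdot>\<^sub>m J_mat n | \<alpha> \<beta>. True}"
proof -
  let ?V = "commutant n {V_mat n t | t. 0 \<le> t \<and> t < 4 * pi}"
  let ?v = "commutant n {v_mat n a | a. a \<in> A_star}"
  let ?S = "{\<alpha> \<cdot>\<^sub>m 1\<^sub>m (n + 1) + \<beta> \<cdot>\<^sub>m J_mat n | \<alpha> \<beta>. True}"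
  have "?S \<subseteq> ?v" using span_subset_commutant_v by blast
  moreover have "?v \<subseteq> ?V" by (rule commutant_v_subset_V)
  moreover have "?V \<subseteq> ?S" using commutant_V_subset_span by blast
  ultimately show ?thesis by blast
qed

end
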